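(* For any $0<\alpha,\beta<1$ and any positive integer $p$, there are positive integers $k,\ell$ such that $\mathrm{Z}_{\alpha,\beta}(G(\ell,k)-v)-\mathrm{Z}_{\alpha,\beta}(G(\ell,k))\ge p$.
   Context: All graphs are finite and simple. $G-v$ denotes the graph obtained from $G$ by deleting the vertex $v$. For positive integers $\ell,k$, $G(\ell,k)$ is the graph obtained by identifying a degree-1 vertex of the path $P_{k+1}$ on $k+1$ vertices with the central vertex of the star $K_{1,\ell}$; the identified vertex is called $v$. Let $\alpha,\beta$ be the transmission proportion and the transmission threshold, let $G$ be a graph and $B\subseteq V(G)$ a set of initially filled vertices. The transmission forcing process started from $B$ is defined as follows. Put $B_0=B$, $w_0(v)=1$ for $v\in B$ and $w_0(v)=0$ for $v\in V(G)\setminus B$. For $t\ge 1$, given the set $B_{t-1}$ of vertices filled at time $t-1$ and the weights $w_{t-1}$: for each unfilled vertex $u\in V(G)\setminus B_{t-1}$ let $\mathcal V_{t,u}$ be the set of all $v\in B_{t-1}$ such that $u$ is the only neighbor of $v$ in $V(G)\setminus B_{t-1}$ and $v\notin \mathcal V_{s,u'}$ for every $s<t$ and every $u'$ (each vertex transmits weight at most once); when $v\in\mathcal V_{t,u}$ we say $v$ forces $u$, written $v\to u$. Set $w_t(u)=w_{t-1}(u)+\sum_{v\in\mathcal V_{t,u}}\alpha\, w_{t-1}(v)$ for $u\in V(G)\setminus B_{t-1}$ and $w_t(u)=w_{t-1}(u)$ for $u\in B_{t-1}$. Then $B_t=B_{t-1}\cup\{u\in V(G)\setminus B_{t-1} :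 w_t(u)\ge\beta\}$. The set $B$ is an $(\alpha,\beta)$-transmission zero forcing set of $G$ if $B_t=V(G)$ for some $t\ge 0$, and the $(\alpha,\beta)$-transmission zero forcing number $\mathrm{Z}_{\alpha,\beta}(G)$ is the minimum cardinality of such a set. *)

theory Defs
  imports Complex_Main "Graph_Theory.Pair_Digraph"
begin

text \<open>
  Finite simple graphs are the instances of the locale \<^locale>\<open>graph\<close> (finite, symmetric,
  loop-free, without parallel arcs); adjacency of \<open>u\<close> and \<open>v\<close> is \<open>u \<rightarrow>\<^bsub>G\<^esub> v\<close>, and \<open>G - v\<close> is
  \<^const>\<open>pre_digraph.del_vert\<close>.
\<close>

section \<open>The transmission forcing process\<close>

text \<open>
  State at time \<open>t\<close>: the filled set \<open>B\<^sub>t\<close>, the weights \<open>w\<^sub>t\<close>, and the set of all vertices that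
  have already transmitted, i.e. the union of the sets \<open>V\<^sub>s\<^sub>,\<^sub>u\<close> over all \<open>s \<le> t\<close> and all \<open>u\<close>
  (see \<open>transmitted_process_iff\<close> below).
\<close>

record 'a transmission_state =
  filled :: "'a set"
  weight :: "'a \<Rightarrow> real"
  transmitted :: "'a set"

text \<open>The set \<open>V\<^sub>t\<^sub>,\<^sub>u\<close>, computed from the state at time \<open>t - 1\<close>.\<close>

definition forcers ::
  "('a, 'b) pre_digraph \<Rightarrow> 'a transmission_state \<Rightarrow> 'a \<Rightarrow> 'a set" where
  "forcers G S u =
     {v \<in> filled S. {x \<in> verts G - filled S. v \<rightarrow>\<^bsub>G\<^esub> x} = {u} \<and> v \<notin> transmitted S}"

definition new_weight ::
  "('a, 'b) pre_digraph \<Rightarrow> real \<Rightarrow> 'a transmission_state \<Rightarrow> 'a \<Rightarrow> real" where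
  "new_weight G \<alpha> S u =
     (if u \<in> verts G - filled S
      then weight S u + (\<Sum>v\<in>forcers G S u. \<alpha> * weight S v)
      else weight S u)"

definition transmission_step ::
  "('a, 'b) pre_digraph \<Rightarrow> real \<Rightarrow> real \<Rightarrow> 'a transmission_state \<Rightarrow> 'a transmission_state" where
  "transmission_step G \<alpha> \<beta> S =
     \<lparr> filled = filled S \<union> {u \<in> verts G - filled S. new_weight G \<alpha> S u \<ge> \<beta>},
       weight = new_weight G \<alpha> S,
       transmitted = transmitted S \<union> (\<Union>u \<in> verts G - filled S. forcers G S u) \<rparr>"

primrec transmission_process ::
  "('a, 'b) pre_digraph \<Rightarrow> real \<Rightarrow> real \<Rightarrow> 'a set \<Rightarrow> nat \<Rightarrow> 'a transmission_state" where
  "transmission_process G \<alpha> \<beta> B 0 =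
     \<lparr> filled = B, weight = (\<lambda>v. if v \<in> B then 1 else 0), transmitted = {} \<rparr>"
| "transmission_process G \<alpha> \<beta> B (Suc t) =
     transmission_step G \<alpha> \<beta> (transmission_process G \<alpha> \<beta> B t)"

definition transmission_zero_forcing_set ::
  "('a, 'b) pre_digraph \<Rightarrow> real \<Rightarrow> real \<Rightarrow> 'a set \<Rightarrow> bool" where
  "transmission_zero_forcing_set G \<alpha> \<beta> B \<longleftrightarrow>
     B \<subseteq> verts G \<and> (\<exists>t. filled (transmission_process G \<alpha> \<beta> B t) = verts G)"

definition transmission_zero_forcing_number ::
  "real \<Rightarrow> real \<Rightarrow> ('a, 'b) pre_digraph \<Rightarrow> nat" where
  "transmission_zero_forcing_number \<alpha> \<beta> G =
     (LEAST n. \<exists>B. transmission_zero_forcing_set G \<alpha> \<beta> B \<and> card B = n)"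

lemma transmitted_process_iff:
  "v \<in> transmitted (transmission_process G \<alpha> \<beta> B t) \<longleftrightarrow>
     (\<exists>s<t. \<exists>u. v \<in> forcers G (transmission_process G \<alpha> \<beta> B s) u)"
proof (induction t)
  case 0
  show ?case by simp
next
  case (Suc t)
  have "v \<in> forcers G S u \<Longrightarrow> u \<in> verts G - filled S" for S u
    unfolding forcers_def by blast
  then show ?case
    using Suc.IH by (auto simp: transmission_step_def less_Suc_eq)
qed

lemma filled_process_subset_verts:
  assumes "B \<subseteq> verts G"
  shows "filled (transmission_process G \<alpha> \<beta> B t) \<subseteq> verts G"
  using assms by (induction t) (auto simp: transmission_step_def)

lemma transmission_zero_forcing_set_verts:
  "transmission_zero_forcing_set G \<alpha> \<beta> (verts G)"
  unfolding transmission_zero_forcing_set_def by (auto intro: exI[of _ 0])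

lemma transmission_zero_forcing_number_attained:
  "\<exists>B. transmission_zero_forcing_set G \<alpha> \<beta> B \<and>
       card B = transmission_zero_forcing_number \<alpha> \<beta> G"
  unfolding transmission_zero_forcing_number_def
  by (rule LeastI_ex) (use transmission_zero_forcing_set_verts in blast)

lemma transmission_zero_forcing_number_le:
  "transmission_zero_forcing_set G \<alpha> \<beta> B \<Longrightarrow>
     transmission_zero_forcing_number \<alpha> \<beta> G \<le> card B"
  unfolding transmission_zero_forcing_number_def by (rule Least_le) blast

section \<open>The graphs \<open>G(\<ell>, k)\<close>\<close>

text \<open>
  \<open>Path 0, \<dots>, Path k\<close> are the consecutive vertices of the path on \<open>k + 1\<close> vertices, and
  \<open>Leaf 0, \<dots>, Leaf (l - 1)\<close> the leaves of the star; the end vertex \<open>Path 0\<close> of the path is also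
  the centre of the star, i.e. it is the identified vertex \<open>v\<close>.
\<close>

datatype path_star_vertex = Path nat | Leaf nat

definition path_star_arcs :: "nat \<Rightarrow> nat \<Rightarrow> path_star_vertex rel" where
  "path_star_arcs l k =
     {(Path i, Path (Suc i)) | i. i < k} \<union> {(Path 0, Leaf j) | j. j < l}"

definition path_star_graph ::
  "nat \<Rightarrow> nat \<Rightarrow> (path_star_vertex, path_star_vertex \<times> path_star_vertex) pre_digraph" where
  "path_star_graph l k = with_proj
     \<lparr> pverts = Path ` {0..k} \<union> Leaf ` {0..<l},
       parcs = path_star_arcs l k \<union> (path_star_arcs l k)\<inverse> \<rparr>"

abbreviation path_star_centre :: path_star_vertex where
  "path_star_centre \<equiv> Path 0"

lemma graph_path_star_graph: "graph (path_star_graph l k)"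
proof -
  let ?P = "\<lparr> pverts = Path ` {0..k} \<union> Leaf ` {0..<l},
              parcs = path_star_arcs l k \<union> (path_star_arcs l k)\<inverse> \<rparr>"
  have sub: "path_star_arcs l k \<union> (path_star_arcs l k)\<inverse> \<subseteq> pverts ?P \<times> pverts ?P"
    by (auto simp: path_star_arcs_def)
  have fin: "finite (path_star_arcs l k \<union> (path_star_arcs l k)\<inverse>)"
    by (rule finite_subset[OF sub]) simp
  have "pair_graph ?P"
  proof unfold_locales
    show "symmetric (with_proj ?P)"
      by (auto simp: symmetric_def sym_def)
  qed (use sub fin in \<open>auto simp: path_star_arcs_def\<close>)
  then show ?thesis
    unfolding path_star_graph_def by (rule pair_graph.pair_graphD_graph)
qed

end

theory Submission
  imports Defs
begin

text \<open>
  Every vertex transmits at most once, passing on a proportion \<open>\<alpha>\<close> of its weight, so the total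
  weight that ever occurs on a component \<open>C\<close> is at most \<open>\<bar>B \<inter> C\<bar> / (1 - \<alpha>)\<close>. As filled vertices
  have weight at least \<open>\<beta>\<close>, filling a path with \<open>k\<close> vertices takes at least \<open>k \<beta> (1 - \<alpha>)\<close> initial
  vertices, a bound that grows with \<open>k\<close>. In \<open>G - v\<close> these come on top of the \<open>\<ell>\<close> isolated leaves,
  whereas in \<open>G\<close> the \<open>\<ell>\<close> leaves alone suffice once \<open>\<ell> \<alpha>\<^sup>k\<^sup>+\<^sup>1 \<ge> \<beta>\<close>, since they
  concentrate the weight \<open>\<ell> \<alpha>\<close> at \<open>v\<close>.
\<close>

section \<open>Weight bounds on an arbitrary graph\<close>

lemma forcers_subset_filled: "forcers G S u \<subseteq> filled S"
  unfolding forcers_def by blast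

lemma forcers_dominates: "v \<in> forcers G S u \<Longrightarrow> v \<rightarrow>\<^bsub>G\<^esub> u"
  unfolding forcers_def by blast

lemma weight_process_nonneg:
  assumes "0 \<le> \<alpha>"
  shows "0 \<le> weight (transmission_process G \<alpha> \<beta> B t) u"
  using assms
  by (induction t arbitrary: u) (auto simp: transmission_step_def new_weight_def intro!: sum_nonneg add_nonneg_nonneg)

text \<open>The weight of a vertex is frozen once it is filled. A vertex filled during the process
  has weight at least \<beta> at that moment; an initial one has weight 1, whence the assumption
  \<beta> \<le> 1.\<close>

lemma weight_process_ge_threshold:
  fixes \<beta> :: real
  assumes "\<beta> \<le> 1" "u \<in> filled (transmission_process G \<alpha> \<beta> B t)"
  shows "\<beta> \<le> weight (transmission_process G \<alpha> \<beta> B t) u"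
  using assms(2)
  by (induction t) (use assms(1) in \<open>auto simp: transmission_step_def new_weight_def\<close>)

text \<open>Ensures that the weights of past transmitters no longer change.\<close>

lemma transmitted_subset_filled:
  "transmitted (transmission_process G \<alpha> \<beta> B t) \<subseteq> filled (transmission_process G \<alpha> \<beta> B t)"
  by (induction t) (use forcers_subset_filled in \<open>fastforce simp: transmission_step_def\<close>)+

text \<open>
  A vertex transmits only after its weight has become final, so all weight beyond the initial
  unit weights is \<open>\<alpha>\<close> times the weight of a transmitting vertex.
\<close>

lemma sum_weight_process_le:
  assumes fin: "finite (verts G)" and B: "B \<subseteq> verts G" and "0 \<le> \<alpha>" and C: "C \<subseteq> verts G"
    and closed: "\<And>u v. u \<in> C \<Longrightarrow> v \<rightarrow>\<^bsub>G\<^esub> u \<Longrightarrow> v \<in> C"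
  shows "sum (weight (transmission_process G \<alpha> \<beta> B t)) C
    \<le> card (B \<inter> C) + \<alpha> * sum (weight (transmission_process G \<alpha> \<beta> B t))
        (C \<inter> transmitted (transmission_process G \<alpha> \<beta> B t))"
proof (induction t)
  case 0
  have "finite C" using fin C finite_subset by blast
  then show ?case by (simp add: sum.If_cases Int_commute)
next
  case (Suc t)
  define S where "S = transmission_process G \<alpha> \<beta> B t"
  define S' where "S' = transmission_process G \<alpha> \<beta> B (Suc t)"
  \<comment> \<open>The vertices that transmit into \<open>C\<close> in this step; since
    \<open>C\<close> has no incoming arcs from outside, they lie in \<open>C\<close>
    themselves.\<close>
  define N where "N = (\<Union>u \<in> C - filled S. forcers G S u)"
  have S': "S' = transmission_step G \<alpha> \<beta> S" by (simp add: S_def S'_def)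
  have finC: "finite C" using fin C finite_subset by blast
  have fill: "filled S \<subseteq> verts G"
    unfolding S_def by (rule filled_process_subset_verts[OF B])
  have finF: "finite (forcers G S u)" for u
    using forcers_subset_filled fill fin by (meson finite_subset)
  have NC: "N \<subseteq> C"
    unfolding N_def by (auto intro: closed dest: forcers_dominates)
  have Nfilled: "N \<subseteq> filled S"
    unfolding N_def by (rule UN_least) (rule forcers_subset_filled)
  have Nnew: "N \<inter> transmitted S = {}"
    unfolding N_def forcers_def by blast
  have sub: "transmitted S \<subseteq> filled S"
    unfolding S_def by (rule transmitted_subset_filled)
  have w': "weight S' = new_weight G \<alpha> S" by (simp add: S' transmission_step_def)
  have "sum (weight S') C
      = (\<Sum>u\<in>C. weight S u + (if u \<in> C - filled S then \<Sum>v\<in>forcers G S u. \<alpha> * weight S v else 0))"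
    unfolding w' by (rule sum.cong) (use C in \<open>auto simp: new_weight_def\<close>)
  also have "\<dots> = sum (weight S) C
      + (\<Sum>u\<in>C. if u \<in> C - filled S then \<Sum>v\<in>forcers G S u. \<alpha> * weight S v else 0)"
    by (rule sum.distrib)
  finally have "sum (weight S') C = sum (weight S) C
      + (\<Sum>u\<in>C. if u \<in> C - filled S then \<Sum>v\<in>forcers G S u. \<alpha> * weight S v else 0)" .
  moreover have "(\<Sum>u\<in>C. if u \<in> C - filled S then \<Sum>v\<in>forcers G S u. \<alpha> * weight S v else 0)
      = (\<Sum>u\<in>C - filled S. \<Sum>v\<in>forcers G S u. \<alpha> * weight S v)"
    by (rule sum.mono_neutral_cong_right) (use finC in auto)
  \<comment> \<open>A forcer has exactly one unfilled neighbour, so different targets have disjoint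
    sets of forcers and no vertex is counted twice.\<close>
  moreover have "\<dots> = \<alpha> * sum (weight S) N"
    unfolding N_def sum_distrib_left
    by (rule sum.UNION_disjoint[symmetric]) (use finC finF in \<open>auto simp: forcers_def\<close>)
  moreover have "sum (weight S) C \<le> card (B \<inter> C) + \<alpha> * sum (weight S) (C \<inter> transmitted S)"
    using Suc.IH by (simp add: S_def)
  moreover have "sum (weight S) (C \<inter> transmitted S) + sum (weight S) N
      = sum (weight S) (C \<inter> transmitted S \<union> N)"
    by (rule sum.union_disjoint[symmetric]) (use Nnew finC finite_subset[OF NC finC] in blast)+
  \<comment> \<open>Old and new transmitters are all filled in \<open>S\<close>, so the step leaves
    their weights unchanged.\<close>
  moreover have "\<dots> = sum (weight S') (C \<inter> transmitted S \<union> N)"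
    unfolding w' using Nfilled sub by (intro sum.cong) (auto simp: new_weight_def)
  moreover have "\<dots> \<le> sum (weight S') (C \<inter> transmitted S')"
  proof (rule sum_mono2)
    show "finite (C \<inter> transmitted S')" using finC by blast
    have "N \<subseteq> transmitted S'"
      unfolding N_def S' transmission_step_def using C by auto
    moreover have "transmitted S \<subseteq> transmitted S'"
      unfolding S' transmission_step_def by simp
    ultimately show "C \<inter> transmitted S \<union> N \<subseteq> C \<inter> transmitted S'"
      using NC by blast
    show "0 \<le> weight S' u" for u
      unfolding S'_def by (rule weight_process_nonneg[OF \<open>0 \<le> \<alpha>\<close>])
  qed
  ultimately have "sum (weight S') C
      \<le> card (B \<inter> C) + \<alpha> * (sum (weight S) (C \<inter> transmitted S) + sum (weight S) N)"
    and "sum (weight S) (C \<inter> transmitted S) + sum (weight S) N \<le> sum (weight S') (C \<inter> transmitted S')"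
    unfolding distrib_left by linarith+
  from this(1) mult_left_mono[OF this(2) \<open>0 \<le> \<alpha>\<close>] show ?case
    unfolding S'_def by linarith
qed

text \<open>Once everything is filled, the total weight W on \<open>C\<close> satisfies both card C
  * \<beta> \<le> W and W \<le> card (B \<inter> C) + \<alpha> * W; eliminate W. The closure
  condition makes \<open>C\<close> a union of components when the graph is symmetric.\<close>

lemma transmission_zero_forcing_set_card_Int_ge:
  fixes \<alpha> \<beta> :: real
  assumes fin: "finite (verts G)" and B: "transmission_zero_forcing_set G \<alpha> \<beta> B"
    and \<alpha>: "0 \<le> \<alpha>" "\<alpha> \<le> 1" and "\<beta> \<le> 1" and C: "C \<subseteq> verts G"
    and closed: "\<And>u v. u \<in> C \<Longrightarrow> v \<rightarrow>\<^bsub>G\<^esub> u \<Longrightarrow> v \<in> C"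
  shows "card C * \<beta> * (1 - \<alpha>) \<le> card (B \<inter> C)"
proof -
  obtain t where "filled (transmission_process G \<alpha> \<beta> B t) = verts G" and BV: "B \<subseteq> verts G"
    using B unfolding transmission_zero_forcing_set_def by blast
  define S where "S = transmission_process G \<alpha> \<beta> B t"
  have full: "filled S = verts G" by (simp add: S_def) fact
  have finC: "finite C" using fin C finite_subset by blast
  have "\<beta> \<le> weight S u" if "u \<in> C" for u
    unfolding S_def
    by (rule weight_process_ge_threshold[OF \<open>\<beta> \<le> 1\<close>]) (use that full C S_def in blast)
  then have "card C * \<beta> \<le> sum (weight S) C"
    by (rule sum_bounded_below)
  then have "card C * \<beta> * (1 - \<alpha>) \<le> sum (weight S) C * (1 - \<alpha>)"
    using \<alpha> by (intro mult_right_mono) auto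
  moreover have "sum (weight S) C \<le> card (B \<inter> C) + \<alpha> * sum (weight S) (C \<inter> transmitted S)"
    unfolding S_def by (rule sum_weight_process_le[OF fin BV \<alpha>(1) C closed])
  moreover have "\<alpha> * sum (weight S) (C \<inter> transmitted S) \<le> \<alpha> * sum (weight S) C"
    unfolding S_def
    by (intro mult_left_mono sum_mono2 weight_process_nonneg \<alpha>(1) finC) blast
  ultimately show ?thesis by (simp add: algebra_simps)
qed

text \<open>Without forcers the weight stays 0, below the threshold; both facts are carried through
  the induction together.\<close>

lemma isolated_in_transmission_zero_forcing_set:
  assumes B: "transmission_zero_forcing_set G \<alpha> \<beta> B" and "0 < \<beta>"
    and u: "u \<in> verts G" "\<And>v. \<not> v \<rightarrow>\<^bsub>G\<^esub> u"
  shows "u \<in> B"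
proof (rule ccontr)
  assume "u \<notin> B"
  have no: "forcers G S u = {}" for S :: "'a transmission_state"
    using forcers_dominates u(2) by fast
  have "u \<notin> filled (transmission_process G \<alpha> \<beta> B t) \<and> weight (transmission_process G \<alpha> \<beta> B t) u = 0" for t
    by (induction t) (use \<open>u \<notin> B\<close> \<open>0 < \<beta>\<close> no in \<open>auto simp: transmission_step_def new_weight_def\<close>)
  then show False using B u(1) unfolding transmission_zero_forcing_set_def by auto
qed

section \<open>The star with a path, before and after deleting the centre\<close>

lemma verts_path_star_graph: "verts (path_star_graph l k) = Path ` {..k} \<union> Leaf ` {..<l}"
  by (auto simp: path_star_graph_def)

lemma path_star_graph_dominates_iff:
  "u \<rightarrow>\<^bsub>path_star_graph l k\<^esub> v \<longleftrightarrow> (u, v) \<in> path_star_arcs l k \<or> (v, u) \<in> path_star_arcs l k"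
  by (auto simp: path_star_graph_def arcs_ends_def arc_to_ends_def)

lemma path_star_graph_leaf_neighbours:
  "j < l \<Longrightarrow> Leaf j \<rightarrow>\<^bsub>path_star_graph l k\<^esub> x \<longleftrightarrow> x = Path 0"
  by (auto simp: path_star_graph_dominates_iff path_star_arcs_def)

lemma path_star_graph_path_neighbours:
  "Path i \<rightarrow>\<^bsub>path_star_graph l k\<^esub> Path j \<longleftrightarrow> j = Suc i \<and> i < k \<or> i = Suc j \<and> j < k"
  by (auto simp: path_star_graph_dominates_iff path_star_arcs_def)

text \<open>The first step fills the centre from all leaves at once, which is why time
  \<open>Suc s\<close> corresponds to \<open>Path s\<close>. Afterwards the weight travels along the
  path, losing a factor \<alpha> per edge; \<open>Path s\<close> has yet to transmit.\<close>

lemma transmission_process_leaves: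
  fixes \<alpha> \<beta> :: real
  assumes "0 \<le> \<alpha>" "\<alpha> \<le> 1" "0 < \<beta>" "\<beta> \<le> l * \<alpha> ^ Suc k" "s \<le> k"
  shows "transmission_process (path_star_graph l k) \<alpha> \<beta> (Leaf ` {..<l}) (Suc s) =
    \<lparr> filled = Leaf ` {..<l} \<union> Path ` {..s},
      weight = (\<lambda>x. case x of Leaf j \<Rightarrow> if j < l then 1 else 0
                  | Path i \<Rightarrow> if i \<le> s then l * \<alpha> ^ Suc i else 0),
      transmitted = Leaf ` {..<l} \<union> Path ` {..<s} \<rparr>"
  using assms(5)
proof (induction s)
  case 0
  let ?S = "\<lparr> filled = Leaf ` {..<l}, weight = \<lambda>v. if v \<in> Leaf ` {..<l} then 1 else (0::real),
              transmitted = {} \<rparr>"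
  \<comment> \<open>All leaves are filled, so only path vertices can receive weight.\<close>
  have F: "forcers (path_star_graph l k) ?S (Path i) = (if i = 0 then Leaf ` {..<l} else {})" for i
    by (auto simp: forcers_def path_star_graph_leaf_neighbours verts_path_star_graph
        cong: conj_cong)
  have W: "new_weight (path_star_graph l k) \<alpha> ?S = (\<lambda>x. case x of Leaf j \<Rightarrow> if j < l then 1 else 0
                  | Path i \<Rightarrow> if i \<le> 0 then l * \<alpha> ^ Suc i else 0)"
    by (rule ext) (auto simp: new_weight_def F verts_path_star_graph sum.reindex card_image
        inj_on_def split: path_star_vertex.split)
  \<comment> \<open>Weights decrease along the path, so meeting the threshold at the far end
    \<open>Path k\<close> implies meeting it everywhere.\<close>
  have "\<beta> \<le> l * \<alpha>"
    using assms(4) power_decreasing[of 1 "Suc k" \<alpha>] assms(1,2)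
      mult_left_mono[of "\<alpha> ^ Suc k" \<alpha> "real l"] by auto
  then show ?case
    using assms(3) by (auto simp: transmission_step_def W F verts_path_star_graph split: if_splits)
next
  case (Suc s)
  let ?S = "\<lparr> filled = Leaf ` {..<l} \<union> Path ` {..s},
      weight = (\<lambda>x. case x of Leaf j \<Rightarrow> if j < l then 1 else 0
                  | Path i \<Rightarrow> if i \<le> s then l * \<alpha> ^ Suc i else 0),
      transmitted = Leaf ` {..<l} \<union> Path ` {..<s} \<rparr>"
  have V: "x \<in> verts (path_star_graph l k) - filled ?S \<longleftrightarrow> (\<exists>i. x = Path i \<and> s < i \<and> i \<le> k)" for x
    by (auto simp: verts_path_star_graph)
  have nbr: "{x \<in> verts (path_star_graph l k) - filled ?S. Path s \<rightarrow>\<^bsub>path_star_graph l k\<^esub> x} = {Path (Suc s)}"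
    using Suc.prems unfolding V by (auto simp: path_star_graph_path_neighbours)
  \<comment> \<open>Every other filled vertex has spent its single transmission, so
    \<open>Path s\<close> is the only possible forcer.\<close>
  have active: "v \<in> filled ?S \<and> v \<notin> transmitted ?S \<longleftrightarrow> v = Path s" for v
    by auto
  have "v \<in> forcers (path_star_graph l k) ?S u \<longleftrightarrow> v = Path s \<and> u = Path (Suc s)" for u v
  proof -
    have "v \<in> forcers (path_star_graph l k) ?S u \<longleftrightarrow> (v \<in> filled ?S \<and> v \<notin> transmitted ?S) \<and>
        {x \<in> verts (path_star_graph l k) - filled ?S. v \<rightarrow>\<^bsub>path_star_graph l k\<^esub> x} = {u}"
      unfolding forcers_def by blast
    then show ?thesis unfolding active using nbr by auto
  qed
  then have F: "forcers (path_star_graph l k) ?S u = (if u = Path (Suc s) then {Path s} else {})" for u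
    by auto
  have W: "new_weight (path_star_graph l k) \<alpha> ?S = (\<lambda>x. case x of Leaf j \<Rightarrow> if j < l then 1 else 0
                  | Path i \<Rightarrow> if i \<le> Suc s then l * \<alpha> ^ Suc i else 0)"
    using Suc.prems unfolding new_weight_def V
    by (intro ext) (auto simp: F split: path_star_vertex.split)
  have "\<beta> \<le> l * \<alpha> ^ Suc (Suc s)"
    using assms(4) power_decreasing[of "Suc (Suc s)" "Suc k" \<alpha>] assms(1,2) Suc.prems
      mult_left_mono[of "\<alpha> ^ Suc k" "\<alpha> ^ Suc (Suc s)" "real l"] by auto
  moreover have "transmission_process (path_star_graph l k) \<alpha> \<beta> (Leaf ` {..<l}) (Suc s) = ?S"
    using Suc by simp
  then have "transmission_process (path_star_graph l k) \<alpha> \<beta> (Leaf ` {..<l}) (Suc (Suc s)) =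
     transmission_step (path_star_graph l k) \<alpha> \<beta> ?S"
    by simp
  moreover have "(\<Union>u\<in>verts (path_star_graph l k) - filled ?S. forcers (path_star_graph l k) ?S u) = {Path s}"
  proof -
    have "Path (Suc s) \<in> verts (path_star_graph l k) - filled ?S"
      unfolding V using Suc.prems by blast
    then show ?thesis unfolding F by (intro equalityI UN_least) (auto intro: UN_I split: if_splits)
  qed
  moreover have "{u \<in> verts (path_star_graph l k) - filled ?S. new_weight (path_star_graph l k) \<alpha> ?S u \<ge> \<beta>} = {Path (Suc s)}"
    unfolding W V using Suc.prems \<open>\<beta> \<le> l * \<alpha> ^ Suc (Suc s)\<close> assms(3) by (auto split: if_splits)
  ultimately show ?case
    unfolding transmission_step_def W by (simp add: atMost_Suc lessThan_Suc)
qed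

lemma transmission_zero_forcing_number_path_star_le:
  fixes \<alpha> \<beta> :: real
  assumes "0 \<le> \<alpha>" "\<alpha> \<le> 1" "0 < \<beta>" "\<beta> \<le> l * \<alpha> ^ Suc k"
  shows "transmission_zero_forcing_number \<alpha> \<beta> (path_star_graph l k) \<le> l"
proof -
  have "transmission_zero_forcing_set (path_star_graph l k) \<alpha> \<beta> (Leaf ` {..<l})"
    unfolding transmission_zero_forcing_set_def
    using transmission_process_leaves[OF assms order_refl]
    by (auto simp: verts_path_star_graph intro!: exI[of _ "Suc k"])
  then show ?thesis
    using transmission_zero_forcing_number_le by (fastforce simp: card_image inj_on_def)
qed

lemma transmission_zero_forcing_number_path_star_del_centre_ge:
  fixes \<alpha> \<beta> :: real
  assumes "0 \<le> \<alpha>" "\<alpha> \<le> 1" "0 < \<beta>" "\<beta> \<le> 1"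
  shows "l + k * \<beta> * (1 - \<alpha>) \<le> transmission_zero_forcing_number \<alpha> \<beta>
    (pre_digraph.del_vert (path_star_graph l k) path_star_centre)"
proof -
  let ?H = "pre_digraph.del_vert (path_star_graph l k) path_star_centre"
  let ?P = "Path ` {1..k}" and ?L = "Leaf ` {..<l}"
  have verts: "verts ?H = ?P \<union> ?L"
    by (auto simp: pre_digraph.verts_del_vert verts_path_star_graph)
  \<comment> \<open>This yields both that the leaves are isolated in \<open>?H\<close> and that
    \<open>?P\<close> is closed, so the two lower bounds apply to disjoint parts of \<open>B\<close>
    and add up.\<close>
  have arcs: "u \<in> ?P \<and> v \<in> ?P" if "u \<rightarrow>\<^bsub>?H\<^esub> v" for u v
    using that
    by (auto simp: pre_digraph.del_vert_def path_star_graph_def path_star_arcs_def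
        arcs_ends_def arc_to_ends_def)
  obtain B where B: "transmission_zero_forcing_set ?H \<alpha> \<beta> B"
      and card: "card B = transmission_zero_forcing_number \<alpha> \<beta> ?H"
    using transmission_zero_forcing_number_attained by blast
  have "?L \<subseteq> B"
  proof
    fix u assume "u \<in> ?L"
    then have "u \<in> verts ?H" "u \<notin> ?P" by (auto simp: verts)
    then show "u \<in> B"
      using isolated_in_transmission_zero_forcing_set[OF B \<open>0 < \<beta>\<close>] arcs by metis
  qed
  have "card ?P * \<beta> * (1 - \<alpha>) \<le> card (B \<inter> ?P)"
  proof (rule transmission_zero_forcing_set_card_Int_ge[OF _ B assms(1,2,4)])
    show "finite (verts ?H)" "?P \<subseteq> verts ?H" by (simp_all add: verts)
    show "v \<in> ?P" if "v \<rightarrow>\<^bsub>?H\<^esub> u" for u v using arcs[OF that] by simp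
  qed
  moreover have "B = ?L \<union> (B \<inter> ?P)"
    using B \<open>?L \<subseteq> B\<close> unfolding transmission_zero_forcing_set_def verts by blast
  then have "card B = card (?L \<union> (B \<inter> ?P))"
    by (rule arg_cong)
  then have "card B = card ?L + card (B \<inter> ?P)"
    by (simp only:) (rule card_Un_disjoint, auto)
  moreover have "card ?L = l" "card ?P = k"
    by (simp_all add: card_image inj_on_def)
  ultimately show ?thesis
    using card by simp
qed

theorem theorem5p1p1:
  fixes \<alpha> \<beta> :: real and p :: nat
  assumes "0 < \<alpha>" and "\<alpha> < 1" and "0 < \<beta>" and "\<beta> < 1" and "0 < p"
  shows "\<exists>k l :: nat. 0 < k \<and> 0 < l \<and>
    int (transmission_zero_forcing_number \<alpha> \<beta>
           (pre_digraph.del_vert (path_star_graph l k) path_star_centre))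
    - int (transmission_zero_forcing_number \<alpha> \<beta> (path_star_graph l k)) \<ge> int p"
proof -
  \<comment> \<open>The path length is fixed first, to make the surplus after deletion exceed
    \<open>p\<close>; only then is \<open>l\<close> taken large enough to push weight \<beta> to the
    end of that path.\<close>
  obtain k :: nat where k: "p < k * (\<beta> * (1 - \<alpha>))"
    using reals_Archimedean3[of "\<beta> * (1 - \<alpha>)"] assms by auto
  obtain l :: nat where l: "\<beta> < l * \<alpha> ^ Suc k"
    using reals_Archimedean3[of "\<alpha> ^ Suc k"] assms by auto
  have "l + k * \<beta> * (1 - \<alpha>) \<le> transmission_zero_forcing_number \<alpha> \<beta>
      (pre_digraph.del_vert (path_star_graph l k) path_star_centre)" (is "_ \<le> real ?Z")
    using assms by (intro transmission_zero_forcing_number_path_star_del_centre_ge) auto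
  then have "real (l + p) \<le> real ?Z" using k by (simp add: mult.assoc)
  then have "l + p \<le> ?Z" by linarith
  moreover have "transmission_zero_forcing_number \<alpha> \<beta> (path_star_graph l k) \<le> l"
    using assms l by (intro transmission_zero_forcing_number_path_star_le) auto
  moreover have "0 < k" "0 < l"
    using k l assms by (auto intro!: gr0I)
  ultimately show ?thesis
    by (intro exI[of _ k] exI[of _ l]) linarith
qed

end
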